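(* Let $u \in \mathbb{Z}_{\ge 0}^m$ be a vector of counts with $n := \sum_{j=1}^m u_j \ge 1$, let $A \in \mathbb{Z}^{d\times m}$ be a matrix whose row span contains the all-ones vector $\mathbf{1}$, and let $b = Au \in \mathbb{Z}^d$. Consider the action of the complex torus $(\mathbb{C}^\times)^d$ on $\mathbb{C}^m$ given by the matrix $nA$ with linearization $b$, and the vector $\mathbf{1} = (1,\dots,1)\in\mathbb{C}^m$. Then: (a) $\mathbf{1}$ is never unstable; (b) $\mathbf{1}$ is semistable if and only if the extended MLE given $u$ for the log-linear model $\mathcal{M}_A$ exists and is unique; (c) $\mathbf{1}$ is polystable if and only if the MLE given $u$ in $\mathcal{M}_A$ exists and is unique; (d) $\mathbf{1}$ is never stable.
   Context: Torus action: for $B = (B_{ij}) \in \mathbb{Z}^{d\times m}$ and $b \in \mathbb{Z}^d$, the action of $(\mathbb{C}^\times)^d$ on $\mathbb{C}^m$ given by the matrix $B$ with linearization $b$ is $(\lambda\cdot v)_j = \lambda_1^{B_{1j}-b_1}\cdots\lambda_d^{B_{dj}-b_d}\, v_j$ for $\lambda\in(\mathbb{C}^\times)^d$, $v \in \mathbb{C}^m$. Stability: for a group $G$ acting linearly on $\mathbb{C}^m$, with closures taken in the Euclidean topology, a vector $v\in\mathbb{C}^m$ is unstable if $0\in\overline{G\cdot v}$; semistable if $0\notin\overline{G\cdot v}$; polystable if $v\ne 0$ and the orbit $G\cdot v$ is closed; stable if $v$ is polystable and the stabilizer $G_v = \{g \in G : g\cdot v = v\}$ is finite. Log-linear model: $\Delta_{m-1}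 = \{p\in\mathbb{R}^m : p_j\ge 0 \text{ for all } j,\ \sum_j p_j = 1\}$ is the probability simplex, and $\mathcal{M}_A = \{p\in\Delta_{m-1} : p_j > 0 \text{ for all } j,\ \log p \in \mathrm{rowspan}(A)\}$, where $\log$ is applied coordinatewise and the row span is over $\mathbb{R}$. The extended log-linear model $\overline{\mathcal{M}_A}$ is the closure of $\mathcal{M}_A$ in the Euclidean topology on $\mathbb{R}^m$. MLE: an MLE given $u$ in $\mathcal{M}_A$ is a maximizer over $\mathcal{M}_A$ of the likelihood function $L_u(p) = p_1^{u_1}\cdots p_m^{u_m}$ (with $0^0=1$). The extended MLE given $u$ is a maximizer of $L_u$ over $\overline{\mathcal{M}_A}$. *)

theory Defs
  imports "HOL-Analysis.Analysis" "HOL-Algebra.Group_Action"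
begin

text \<open>The group of units of the componentwise ring structure on the vector type.\<close>

definition complex_torus :: "(complex ^ 'd) monoid" where
  "complex_torus = \<lparr>carrier = {l. \<forall>i. l $ i \<noteq> 0}, mult = (*), one = 1\<rparr>"

definition torus_act :: "int ^ 'm ^ 'd \<Rightarrow> int ^ 'd \<Rightarrow> complex ^ 'd \<Rightarrow> complex ^ 'm \<Rightarrow> complex ^ 'm" where
  "torus_act B b l v = (\<chi> j. (\<Prod>i\<in>UNIV. (l $ i) powi (B $ i $ j - b $ i)) * v $ j)"

text \<open>The stability notions are meant for a group \<open>G\<close> acting linearly through \<open>\<phi>\<close>;
  closures are Euclidean.\<close>

definition is_unstable :: "('g, 'e) monoid_scheme \<Rightarrow> ('g \<Rightarrow> complex ^ 'm \<Rightarrow> complex ^ 'm) \<Rightarrow> complex ^ 'm \<Rightarrow> bool" where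
  "is_unstable G \<phi> v \<longleftrightarrow> 0 \<in> closure (orbit G \<phi> v)"

definition is_semistable :: "('g, 'e) monoid_scheme \<Rightarrow> ('g \<Rightarrow> complex ^ 'm \<Rightarrow> complex ^ 'm) \<Rightarrow> complex ^ 'm \<Rightarrow> bool" where
  "is_semistable G \<phi> v \<longleftrightarrow> 0 \<notin> closure (orbit G \<phi> v)"

definition is_polystable :: "('g, 'e) monoid_scheme \<Rightarrow> ('g \<Rightarrow> complex ^ 'm \<Rightarrow> complex ^ 'm) \<Rightarrow> complex ^ 'm \<Rightarrow> bool" where
  "is_polystable G \<phi> v \<longleftrightarrow> v \<noteq> 0 \<and> closed (orbit G \<phi> v)"

definition is_stable :: "('g, 'e) monoid_scheme \<Rightarrow> ('g \<Rightarrow> complex ^ 'm \<Rightarrow> complex ^ 'm) \<Rightarrow> complex ^ 'm \<Rightarrow> bool" where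
  "is_stable G \<phi> v \<longleftrightarrow> is_polystable G \<phi> v \<and> finite (stabilizer G \<phi> v)"

lemma group_complex_torus: "group (complex_torus :: (complex ^ 'd) monoid)"
proof (rule groupI)
  fix x :: "complex ^ 'd"
  assume "x \<in> carrier complex_torus"
  then have "(\<chi> i. inverse (x $ i)) \<in> carrier complex_torus"
      "(\<chi> i. inverse (x $ i)) \<otimes>\<^bsub>complex_torus\<^esub> x = \<one>\<^bsub>complex_torus\<^esub>"
    by (auto simp: complex_torus_def vec_eq_iff)
  then show "\<exists>y\<in>carrier complex_torus. y \<otimes>\<^bsub>complex_torus\<^esub> x = \<one>\<^bsub>complex_torus\<^esub>"
    by blast
qed (auto simp: complex_torus_def mult.assoc)

lemma linear_torus_act: "Vector_Spaces.linear (*s) (*s) (torus_act B b l)"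
  by (unfold_locales) (auto simp: torus_act_def vec_eq_iff algebra_simps)

lemma torus_act_one: "torus_act B b 1 v = v"
  by (simp add: torus_act_def vec_eq_iff)

lemma torus_act_mult: "torus_act B b (l * l') v = torus_act B b l (torus_act B b l' v)"
  by (simp add: torus_act_def vec_eq_iff power_int_mult_distrib prod.distrib mult.assoc)

lemma group_action_torus_act: "group_action complex_torus UNIV (torus_act B b)"
proof -
  have inv: "torus_act B b (\<chi> i. inverse (l $ i)) (torus_act B b l v) = v"
       "torus_act B b l (torus_act B b (\<chi> i. inverse (l $ i)) v) = v"
    if "l \<in> carrier complex_torus" for l v
  proof -
    have "(\<chi> i. inverse (l $ i)) * l = 1" "l * (\<chi> i. inverse (l $ i)) = 1"
      using that by (auto simp: complex_torus_def vec_eq_iff)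
    then show "torus_act B b (\<chi> i. inverse (l $ i)) (torus_act B b l v) = v"
       "torus_act B b l (torus_act B b (\<chi> i. inverse (l $ i)) v) = v"
      by (metis torus_act_mult torus_act_one)+
  qed
  have bij: "bij (torus_act B b l)" if "l \<in> carrier complex_torus" for l
    by (rule o_bij[where g = "torus_act B b (\<chi> i. inverse (l $ i))"])
       (use inv[OF that] in \<open>auto simp: fun_eq_iff\<close>)
  have "torus_act B b \<in> hom complex_torus (BijGroup UNIV)"
  proof (rule homI)
    fix x y :: "complex ^ 'a"
    assume xy: "x \<in> carrier complex_torus" "y \<in> carrier complex_torus"
    show "torus_act B b (x \<otimes>\<^bsub>complex_torus\<^esub> y) = torus_act B b x \<otimes>\<^bsub>BijGroup UNIV\<^esub> torus_act B b y"
      using bij[OF xy(1)] bij[OF xy(2)]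
      by (auto simp: BijGroup_def Bij_def complex_torus_def torus_act_mult fun_eq_iff compose_def)
  qed (use bij in \<open>auto simp: BijGroup_def Bij_def\<close>)
  then show ?thesis
    by (simp add: group_action_def group_hom_def group_hom_axioms_def
        group_complex_torus group_BijGroup)
qed

definition real_rowspan :: "int ^ 'm ^ 'd \<Rightarrow> (real ^ 'm) set" where
  "real_rowspan A = span (rows (\<chi> i j. real_of_int (A $ i $ j)))"

definition prob_simplex :: "(real ^ 'm) set" where
  "prob_simplex = {p. (\<forall>j. p $ j \<ge> 0) \<and> (\<Sum>j\<in>UNIV. p $ j) = 1}"

definition log_linear_model :: "int ^ 'm ^ 'd \<Rightarrow> (real ^ 'm) set" where
  "log_linear_model A =
    {p \<in> prob_simplex. (\<forall>j. p $ j > 0) \<and> (\<chi> j. ln (p $ j)) \<in> real_rowspan A}"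

definition extended_log_linear_model :: "int ^ 'm ^ 'd \<Rightarrow> (real ^ 'm) set" where
  "extended_log_linear_model A = closure (log_linear_model A)"

text \<open>Powers with exponent in \<open>nat\<close>, hence the convention \<open>0 ^ 0 = 1\<close>.\<close>

definition likelihood :: "nat ^ 'm \<Rightarrow> real ^ 'm \<Rightarrow> real" where
  "likelihood u p = (\<Prod>j\<in>UNIV. (p $ j) ^ (u $ j))"

definition is_MLE :: "nat ^ 'm \<Rightarrow> int ^ 'm ^ 'd \<Rightarrow> real ^ 'm \<Rightarrow> bool" where
  "is_MLE u A p \<longleftrightarrow> is_arg_max (likelihood u) (\<lambda>q. q \<in> log_linear_model A) p"

definition is_extended_MLE :: "nat ^ 'm \<Rightarrow> int ^ 'm ^ 'd \<Rightarrow> real ^ 'm \<Rightarrow> bool" where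
  "is_extended_MLE u A p \<longleftrightarrow> is_arg_max (likelihood u) (\<lambda>q. q \<in> extended_log_linear_model A) p"

end

theory Submission
  imports Defs
begin

text \<open>The monomial with exponents \<open>u\<close> is invariant under the torus, which settles (a) and the
  left-hand side of (b); the right-hand side also always holds, by compactness and strict log-concavity
  along geometric means. For (c), both the likelihood on the model and the norm on the orbit are
  governed by the same sum of exponentials of the weights: the MLE corresponds to a minimiser of it,
  and so does a closed orbit. For (d), a real combination of the rows of \<open>A\<close> equal to \<open>1\<close> spans
  a one-parameter subgroup fixing \<open>1\<close>.\<close>

section \<open>Row span and real weights of the torus action\<close>

text \<open>The rows are the columns of the transpose \<open>T\<close>, so their span is the range
  of \<open>T\<close>. The coefficient vector \<theta>, up to scaling, later serves as the logarithm
  of a positive torus element.\<close>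

lemma mem_real_rowspan_iff:
  "x \<in> real_rowspan A \<longleftrightarrow> (\<exists>\<theta> :: real ^ 'd. \<forall>j. x $ j = (\<Sum>i\<in>UNIV. \<theta> $ i * of_int (A $ i $ j)))"
  for A :: "int ^ 'm ^ 'd"
proof -
  define T :: "real ^ 'd ^ 'm" where "T = transpose (\<chi> i j. real_of_int (A $ i $ j))"
  have "real_rowspan A = span (columns T)"
    by (simp add: real_rowspan_def T_def)
  also have "\<dots> = (*v) T ` span (range (\<lambda>i. axis i 1))"
    by (simp add: columns_image_basis linear_span_image)
  also have "range (\<lambda>i. axis i (1 :: real)) = (Basis :: (real ^ 'd) set)"
    by (auto simp: Basis_vec_def)
  also have "(*v) T ` span Basis = range ((*v) T)"
    by simp
  finally show ?thesis
    by (auto simp: image_iff vec_eq_iff matrix_vector_mult_def T_def transpose_def mult.commute)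
qed

text \<open>The torus scales coordinate \<open>j\<close> by the character with exponents
  \<open>B $ i $ j - b $ i\<close>. The vector collects the logarithms of these scalings for the
  positive torus element with coordinates \<open>exp (\<theta> $ i)\<close>.\<close>

definition weight :: "int ^ 'm ^ 'd \<Rightarrow> int ^ 'd \<Rightarrow> real ^ 'd \<Rightarrow> real ^ 'm" where
  "weight B b \<theta> = (\<chi> j. \<Sum>i\<in>UNIV. \<theta> $ i * of_int (B $ i $ j - b $ i))"

text \<open>For \<open>B = nA\<close> this is the partition function of the log-linear model at
  parameter \<open>n\<close> times \<theta>, up to the factor \<open>exp (- s)\<close> with
  \<open>s\<close> the pairing of \<theta> and \<open>b\<close>; hence its role on the statistical
  side.\<close>

definition exp_weight_sum :: "int ^ 'm ^ 'd \<Rightarrow> int ^ 'd \<Rightarrow> real ^ 'd \<Rightarrow> real" where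
  "exp_weight_sum B b \<theta> = (\<Sum>j\<in>UNIV. exp (weight B b \<theta> $ j))"

lemma linear_weight: "linear (weight B b)"
  by (rule linearI)
     (auto simp: weight_def vec_eq_iff distrib_right sum.distrib sum_distrib_left mult.assoc)

text \<open>Splits a torus element into moduli and phases: the positive factors come out of the
  integer powers and combine into the exponential of the weight.\<close>

lemma torus_act_one_exp:
  fixes l :: "complex ^ 'd"
  shows "torus_act B b (\<chi> i. of_real (exp (\<theta> $ i)) * l $ i) 1 $ j
    = of_real (exp (weight B b \<theta> $ j)) * torus_act B b l 1 $ j"
  by (simp add: torus_act_def weight_def power_int_mult_distrib prod.distrib exp_sum exp_power_int
      mult.commute flip: of_real_power_int)

text \<open>Phases have modulus one, so only the log-moduli of \<open>l\<close> enter.\<close>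

lemma norm_torus_act_one:
  assumes "l \<in> carrier complex_torus"
  shows "norm (torus_act B b l 1 $ j) = exp (weight B b (\<chi> i. ln (norm (l $ i))) $ j)"
proof -
  have "norm (l $ i) powi k = exp (ln (norm (l $ i)) * of_int k)" for i k
    using assms exp_power_int[of "ln (norm (l $ i))" k]
    by (simp add: complex_torus_def mult.commute)
  then show ?thesis
    by (simp add: torus_act_def weight_def exp_sum norm_power_int flip: prod_norm)
qed

section \<open>Closedness and stabilizer of the orbit of the all-ones vector\<close>

lemma orbit_one_eq:
  "orbit complex_torus (torus_act B b) 1 = (\<lambda>l. torus_act B b l 1) ` carrier complex_torus"
  by (auto simp: orbit_def)

lemma exp_in_complex_torus:
  "l \<in> carrier complex_torus \<Longrightarrow> (\<chi> i. of_real (exp (\<theta> $ i)) * l $ i) \<in> carrier complex_torus"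
  by (simp add: complex_torus_def)

lemma one_in_complex_torus: "1 \<in> carrier complex_torus"
  by (simp add: complex_torus_def)

text \<open>Kempf--Ness: a vector of minimal norm in the orbit is a minimiser of the exponential sum,
  since the squared norm of the point \<open>exp \<theta>\<close> acting on \<open>1\<close> is the sum at \<open>2 \<theta>\<close>.\<close>

lemma exp_weight_sum_attains_min:
  assumes "closed (orbit complex_torus (torus_act B b) 1)"
  shows "\<exists>\<theta>. \<forall>\<eta>. exp_weight_sum B b \<theta> \<le> exp_weight_sum B b \<eta>"
proof -
  let ?O = "orbit complex_torus (torus_act B b) 1"
  have "?O \<noteq> {}"
    using one_in_complex_torus by (auto simp: orbit_one_eq)
  with assms obtain v where v: "v \<in> ?O" "\<And>y. y \<in> ?O \<Longrightarrow> dist 0 v \<le> dist 0 y"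
    using distance_attains_inf by blast
  have norm2: "norm (torus_act B b l 1) ^ 2 = exp_weight_sum B b (2 *\<^sub>R (\<chi> i. ln (norm (l $ i))))"
    if "l \<in> carrier complex_torus" for l
    using that
    by (simp add: norm_vec_def L2_set_def sum_nonneg norm_torus_act_one exp_weight_sum_def
        linear_cmul[OF linear_weight] exp_double)
  obtain l where l: "l \<in> carrier complex_torus" "v = torus_act B b l 1"
    using v(1) by (auto simp: orbit_one_eq)
  have "exp_weight_sum B b (2 *\<^sub>R (\<chi> i. ln (norm (l $ i)))) \<le> exp_weight_sum B b \<eta>" for \<eta>
  proof -
    \<comment> \<open>Squaring the norm doubles the log-moduli, so half of \<eta> is the point whose
      squared norm is the sum at \<eta>.\<close>
    define l' :: "complex ^ 'b" where "l' = (\<chi> i. of_real (exp (((1/2) *\<^sub>R \<eta>) $ i)) * 1 $ i)"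
    have l': "l' \<in> carrier complex_torus"
      unfolding l'_def by (rule exp_in_complex_torus[OF one_in_complex_torus])
    have "2 *\<^sub>R (\<chi> i. ln (norm (l' $ i))) = \<eta>"
      by (simp add: l'_def vec_eq_iff)
    moreover have "norm v \<le> norm (torus_act B b l' 1)"
      using v(2)[of "torus_act B b l' 1"] l' by (simp add: orbit_one_eq)
    ultimately show ?thesis
      using norm2[OF l(1)] norm2[OF l'] l(2) by (metis norm_ge_zero power_mono)
  qed
  then show ?thesis by blast
qed

text \<open>First-order condition along the line through \<theta> in direction \<eta>. It supplies a
  relation among the weights with positive coefficients.\<close>

lemma exp_weight_sum_min_critical:
  assumes "\<And>\<eta>. exp_weight_sum B b \<theta> \<le> exp_weight_sum B b \<eta>"
  shows "(\<Sum>j\<in>UNIV. exp (weight B b \<theta> $ j) * weight B b \<eta> $ j) = 0"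
proof -
  let ?f = "\<lambda>t. \<Sum>j\<in>UNIV. exp (weight B b \<theta> $ j + t * weight B b \<eta> $ j)"
  have f: "?f t = exp_weight_sum B b (\<theta> + t *\<^sub>R \<eta>)" for t
    by (simp add: exp_weight_sum_def linear_add[OF linear_weight] linear_cmul[OF linear_weight])
  have "DERIV ?f 0 :> (\<Sum>j\<in>UNIV. exp (weight B b \<theta> $ j) * weight B b \<eta> $ j)"
    by (auto intro!: derivative_eq_intros)
  moreover have "?f 0 \<le> ?f t" for t
    using assms unfolding f by simp
  ultimately show ?thesis
    by (intro DERIV_local_min[of ?f _ 0 1]) auto
qed

lemma compact_unit_torus: "compact {l :: complex ^ 'd. \<forall>i. norm (l $ i) = 1}"
proof -
  have "closed {l :: complex ^ 'd. \<forall>i. norm (l $ i) = 1}"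
    by (intro closed_Collect_all closed_Collect_eq continuous_intros)
  moreover have "norm l \<le> real CARD('d)" if "\<forall>i. norm (l $ i) = 1" for l :: "complex ^ 'd"
    using L2_set_le_sum[of UNIV "\<lambda>i. norm (l $ i)"] that by (simp add: norm_vec_def)
  then have "bounded {l :: complex ^ 'd. \<forall>i. norm (l $ i) = 1}"
    by (auto simp: bounded_iff)
  ultimately show ?thesis
    by (simp add: compact_eq_bounded_closed)
qed

text \<open>A positive relation among the weights keeps limits of orbit points off the coordinate
  hyperplanes. Moduli and phases of orbit points then converge separately: the log-moduli range over
  a linear subspace, the phases over the image of a compact torus.\<close>

lemma closed_orbit_one_if_positive_relation:
  fixes B :: "int ^ 'm ^ 'd"
  assumes w: "\<And>j. w j > 0"
    and rel: "\<And>\<theta>. (\<Sum>j\<in>UNIV. w j * weight B b \<theta> $ j) = 0"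
  shows "closed (orbit complex_torus (torus_act B b) 1)"
  unfolding closed_sequential_limits
proof (intro allI impI, elim conjE)
  fix x v
  assume x: "\<forall>k. x k \<in> orbit complex_torus (torus_act B b) 1" and lim: "x \<longlonglongrightarrow> v"
  have "\<forall>k. \<exists>l. l \<in> carrier complex_torus \<and> x k = torus_act B b l 1"
    using x by (auto simp: orbit_one_eq)
  then obtain l where l: "\<And>k. l k \<in> carrier complex_torus" "\<And>k. x k = torus_act B b (l k) 1"
    by metis
  define \<theta> where "\<theta> k = (\<chi> i. ln (norm (l k $ i)))" for k
  define \<mu> where "\<mu> k = (\<chi> i. sgn (l k $ i))" for k
  have nz: "l k $ i \<noteq> 0" for k i
    using l(1)[of k] by (simp add: complex_torus_def)
  have norm_x: "norm (x k $ j) = exp (weight B b (\<theta> k) $ j)" for k j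
    unfolding l(2) \<theta>_def by (rule norm_torus_act_one[OF l(1)])
  have l_polar: "l k = (\<chi> i. of_real (exp (\<theta> k $ i)) * \<mu> k $ i)" for k
    using nz by (simp add: vec_eq_iff \<theta>_def \<mu>_def sgn_div_norm scaleR_conv_of_real)
  have x_polar: "x k $ j = of_real (norm (x k $ j)) * torus_act B b (\<mu> k) 1 $ j" for k j
  proof -
    have "x k $ j = torus_act B b (l k) 1 $ j"
      by (simp add: l(2))
    also have "\<dots> = of_real (exp (weight B b (\<theta> k) $ j)) * torus_act B b (\<mu> k) 1 $ j"
      by (subst l_polar) (rule torus_act_one_exp)
    finally show ?thesis
      unfolding norm_x .
  qed
  have lim_j: "(\<lambda>k. norm (x k $ j)) \<longlonglongrightarrow> norm (v $ j)" for j
    by (intro tendsto_intros lim)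

  \<comment> \<open>By the relation this generalised monomial is 1 on the orbit. Positive exponents
    make it continuous up to the coordinate hyperplanes, where it vanishes, so the limit lies on
    none of them.\<close>
  have "(\<lambda>k. \<Prod>j\<in>UNIV. norm (x k $ j) powr w j) \<longlonglongrightarrow> (\<Prod>j\<in>UNIV. norm (v $ j) powr w j)"
    using w by (intro tendsto_prod tendsto_powr' lim_j tendsto_const) auto
  moreover have "(\<Prod>j\<in>UNIV. norm (x k $ j) powr w j) = 1" for k
    using rel[of "\<theta> k"] by (simp add: norm_x exp_powr_real mult.commute flip: exp_sum)
  ultimately have "(\<Prod>j\<in>UNIV. norm (v $ j) powr w j) = 1"
    by (simp add: LIMSEQ_const_iff)
  moreover have "(\<Prod>j\<in>UNIV. norm (v $ j) powr w j) = 0" if "v $ j = 0" for j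
    using that by (intro prod_zero bexI[of _ j]) auto
  ultimately have v_nz: "v $ j \<noteq> 0" for j
    by force

  \<comment> \<open>The \<theta> k themselves may diverge; only their weights converge, and the
    limit is again a weight because the range is a linear subspace, hence closed.\<close>
  have closed: "closed (range (weight B b))"
    by (intro closed_subspace linear_subspace_image linear_weight subspace_UNIV)
  have "(\<lambda>k. weight B b (\<theta> k)) \<longlonglongrightarrow> (\<chi> j. ln (norm (v $ j)))"
  proof (rule vec_tendstoI)
    fix j
    have "(\<lambda>k. ln (norm (x k $ j))) \<longlonglongrightarrow> ln (norm (v $ j))"
      using v_nz by (intro tendsto_ln lim_j) auto
    then show "(\<lambda>k. weight B b (\<theta> k) $ j) \<longlonglongrightarrow> (\<chi> j. ln (norm (v $ j))) $ j"
      by (simp add: norm_x)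
  qed
  then have "(\<chi> j. ln (norm (v $ j))) \<in> range (weight B b)"
    by (rule closed_sequentially[OF closed, rotated]) simp
  then obtain \<eta> where \<eta>: "(\<chi> j. ln (norm (v $ j))) = weight B b \<eta>"
    by blast
  have exp_\<eta>: "exp (weight B b \<eta> $ j) = norm (v $ j)" for j
    using v_nz by (simp flip: \<eta>)

  \<comment> \<open>A subsequence of phases converges by compactness; passing to it keeps the limit
    \<open>v\<close>.\<close>
  have \<mu>_in: "\<forall>k. \<mu> k \<in> {l. \<forall>i. norm (l $ i) = 1}"
    using nz by (simp add: \<mu>_def norm_sgn)
  have "seq_compact {l :: complex ^ 'd. \<forall>i. norm (l $ i) = 1}"
    using compact_unit_torus by (simp add: compact_eq_seq_compact_metric)
  then obtain \<nu> r where \<nu>: "\<And>i. norm (\<nu> $ i) = 1" and r: "strict_mono r"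
    and lim_\<mu>: "(\<mu> \<circ> r) \<longlonglongrightarrow> \<nu>"
    using seq_compactE[OF _ \<mu>_in] by blast
  have \<nu>_nz: "\<nu> $ i \<noteq> 0" for i
    using \<nu>[of i] by auto
  have "v $ j = torus_act B b (\<chi> i. of_real (exp (\<eta> $ i)) * \<nu> $ i) 1 $ j" for j
  proof -
    have "(\<lambda>k. norm (x (r k) $ j)) \<longlonglongrightarrow> norm (v $ j)"
      using LIMSEQ_subseq_LIMSEQ[OF lim_j r] by (simp add: o_def)
    moreover have "(\<lambda>k. torus_act B b (\<mu> (r k)) 1 $ j) \<longlonglongrightarrow> torus_act B b \<nu> 1 $ j"
      using lim_\<mu> \<nu>_nz by (auto simp: torus_act_def o_def intro!: tendsto_intros)
    ultimately have "(\<lambda>k. of_real (norm (x (r k) $ j)) * torus_act B b (\<mu> (r k)) 1 $ j)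
        \<longlonglongrightarrow> of_real (norm (v $ j)) * torus_act B b \<nu> 1 $ j"
      by (intro tendsto_mult tendsto_of_real)
    then have "(\<lambda>k. x (r k) $ j) \<longlonglongrightarrow> of_real (norm (v $ j)) * torus_act B b \<nu> 1 $ j"
      by (simp flip: x_polar)
    moreover have "(\<lambda>k. x (r k) $ j) \<longlonglongrightarrow> v $ j"
      using LIMSEQ_subseq_LIMSEQ[OF lim r] by (auto simp: o_def intro: tendsto_intros)
    ultimately show ?thesis
      unfolding torus_act_one_exp exp_\<eta> using LIMSEQ_unique by blast
  qed
  then have "v = torus_act B b (\<chi> i. of_real (exp (\<eta> $ i)) * \<nu> $ i) 1"
    by (simp add: vec_eq_iff)
  moreover have "\<nu> \<in> carrier complex_torus"
    using \<nu>_nz by (simp add: complex_torus_def)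
  ultimately show "v \<in> orbit complex_torus (torus_act B b) 1"
    unfolding orbit_one_eq using exp_in_complex_torus by blast
qed

text \<open>A closed orbit has a point of least norm; conversely, the critical-point equation at a
  minimiser is a positive relation, which closes the orbit.\<close>

lemma is_polystable_one_iff:
  "is_polystable complex_torus (torus_act B b) 1
    \<longleftrightarrow> (\<exists>\<theta>. \<forall>\<eta>. exp_weight_sum B b \<theta> \<le> exp_weight_sum B b \<eta>)"
proof
  assume "\<exists>\<theta>. \<forall>\<eta>. exp_weight_sum B b \<theta> \<le> exp_weight_sum B b \<eta>"
  then obtain \<theta> where "\<And>\<eta>. exp_weight_sum B b \<theta> \<le> exp_weight_sum B b \<eta>"
    by blast
  then have "closed (orbit complex_torus (torus_act B b) 1)"
    by (intro closed_orbit_one_if_positive_relation[of "\<lambda>j. exp (weight B b \<theta> $ j)"]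
        exp_weight_sum_min_critical) auto
  then show "is_polystable complex_torus (torus_act B b) 1"
    by (simp add: is_polystable_def)
qed (auto simp: is_polystable_def exp_weight_sum_attains_min)

text \<open>The one-parameter subgroup \<open>f\<close> in direction \<theta> fixes 1, and it is
  injective because the modulus of a coordinate with nonzero \<theta> entry determines
  \<open>t\<close>.\<close>

lemma infinite_stabilizer_one:
  fixes B :: "int ^ 'm ^ 'd"
  assumes "\<theta> \<noteq> 0" and "weight B b \<theta> = 0"
  shows "infinite (stabilizer complex_torus (torus_act B b) 1)"
proof -
  define f :: "real \<Rightarrow> complex ^ 'd" where "f t = (\<chi> i. of_real (exp ((t *\<^sub>R \<theta>) $ i)) * 1 $ i)" for t
  have "f t \<in> carrier complex_torus" for t
    unfolding f_def by (rule exp_in_complex_torus[OF one_in_complex_torus])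
  moreover have "torus_act B b (f t) 1 = 1" for t
    unfolding f_def using assms(2)
    by (subst vec_eq_iff, unfold torus_act_one_exp)
       (simp add: torus_act_one linear_cmul[OF linear_weight])
  ultimately have sub: "range f \<subseteq> stabilizer complex_torus (torus_act B b) 1"
    by (auto simp: stabilizer_def)
  obtain i where "\<theta> $ i \<noteq> 0"
    using assms(1) by (auto simp: vec_eq_iff)
  moreover have "norm (f t $ i) = exp (t * \<theta> $ i)" for t
    by (simp add: f_def)
  ultimately have "inj f"
    by (metis exp_inj_iff injI mult_right_cancel)
  then have "infinite (range f)"
    using finite_imageD infinite_UNIV_char_0 by blast
  with sub show ?thesis
    using finite_subset by blast
qed

section \<open>Log-linear models and their closures\<close>

lemma log_linear_model_subset: "log_linear_model A \<subseteq> prob_simplex"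
  by (auto simp: log_linear_model_def)

lemma closed_prob_simplex: "closed (prob_simplex :: (real ^ 'm) set)"
  unfolding prob_simplex_def
  by (intro closed_Collect_conj closed_Collect_all closed_Collect_le closed_Collect_eq
      continuous_intros)

lemma bounded_prob_simplex: "bounded (prob_simplex :: (real ^ 'm) set)"
proof -
  have "norm p \<le> 1" if "p \<in> prob_simplex" for p :: "real ^ 'm"
    using norm_le_l1_cart[of p] that by (simp add: prob_simplex_def)
  then show ?thesis
    by (auto simp: bounded_iff)
qed

lemma extended_log_linear_model_subset: "extended_log_linear_model A \<subseteq> prob_simplex"
  unfolding extended_log_linear_model_def
  using closure_minimal[OF log_linear_model_subset closed_prob_simplex] .

lemma compact_extended_log_linear_model: "compact (extended_log_linear_model A)"
  using bounded_subset[OF bounded_prob_simplex extended_log_linear_model_subset]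
  by (simp add: extended_log_linear_model_def compact_eq_bounded_closed)

lemma continuous_on_likelihood: "continuous_on S (likelihood u)"
  unfolding likelihood_def by (intro continuous_intros)

text \<open>Dividing by a constant shifts the logarithms by a multiple of 1, which lies in the row
  span.\<close>

lemma normalize_in_log_linear_model:
  fixes A :: "int ^ 'm ^ 'd"
  assumes A: "1 \<in> real_rowspan A"
    and q: "\<And>j. q $ j > 0" "(\<chi> j. ln (q $ j)) \<in> real_rowspan A"
  shows "(\<chi> j. q $ j / (\<Sum>k\<in>UNIV. q $ k)) \<in> log_linear_model A"
proof -
  let ?Z = "\<Sum>k\<in>UNIV. q $ k"
  have Z: "?Z > 0"
    using q(1) by (intro sum_pos) auto
  have "(\<chi> j. ln (q $ j / ?Z)) = (\<chi> j. ln (q $ j)) - ln ?Z *\<^sub>R 1"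
    using q(1) Z by (simp add: vec_eq_iff ln_divide_pos)
  moreover have "\<dots> \<in> real_rowspan A"
    using A q(2) unfolding real_rowspan_def by (intro span_diff span_scale)
  ultimately show ?thesis
    using q(1) Z by (auto simp: log_linear_model_def prob_simplex_def less_imp_le
        simp flip: sum_divide_distrib)
qed

text \<open>The uniform distribution belongs to the model.\<close>

lemma log_linear_model_nonempty:
  assumes "1 \<in> real_rowspan A"
  shows "log_linear_model A \<noteq> {}"
proof -
  have "(\<chi> j. ln ((1 :: real ^ 'a) $ j)) = 0"
    by (simp add: vec_eq_iff)
  then show ?thesis
    using normalize_in_log_linear_model[OF assms, of 1] by (auto simp: real_rowspan_def span_zero)
qed

lemma sqrt_prod: "sqrt (prod f S) = (\<Prod>x\<in>S. sqrt (f x))"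
  by (induction S rule: infinite_finite_induct) (auto simp: real_sqrt_mult)

text \<open>In logarithmic coordinates the geometric mean is a midpoint, so it stays in the row
  span. The closure inherits this by continuity, provided the limiting normalising constant is
  nonzero.\<close>

lemma extended_log_linear_model_geometric_mean:
  fixes A :: "int ^ 'm ^ 'd"
  assumes A: "1 \<in> real_rowspan A"
    and p: "p \<in> extended_log_linear_model A" and q: "q \<in> extended_log_linear_model A"
    and nz: "(\<Sum>k\<in>UNIV. sqrt (p $ k * q $ k)) \<noteq> 0"
  shows "(\<chi> j. sqrt (p $ j * q $ j) / (\<Sum>k\<in>UNIV. sqrt (p $ k * q $ k)))
    \<in> extended_log_linear_model A"
proof -
  obtain P where P: "\<And>k. P k \<in> log_linear_model A" "P \<longlonglongrightarrow> p"
    using p by (auto simp: extended_log_linear_model_def closure_sequential)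
  obtain Q where Q: "\<And>k. Q k \<in> log_linear_model A" "Q \<longlonglongrightarrow> q"
    using q by (auto simp: extended_log_linear_model_def closure_sequential)
  have in_model: "(\<chi> j. sqrt (P i $ j * Q i $ j) / (\<Sum>k\<in>UNIV. sqrt (P i $ k * Q i $ k)))
    \<in> log_linear_model A" for i
  proof -
    have pos: "P i $ j > 0" "Q i $ j > 0" for j
      using P(1)[of i] Q(1)[of i] by (auto simp: log_linear_model_def)
    have "(\<chi> j. ln (sqrt (P i $ j * Q i $ j)))
        = (1/2) *\<^sub>R ((\<chi> j. ln (P i $ j)) + (\<chi> j. ln (Q i $ j)))"
      using pos by (simp add: vec_eq_iff real_sqrt_mult ln_mult_pos ln_sqrt less_imp_le)
    also have "\<dots> \<in> real_rowspan A"
      using P(1)[of i] Q(1)[of i] unfolding real_rowspan_def log_linear_model_def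
      by (intro span_scale span_add) auto
    finally show ?thesis
      using normalize_in_log_linear_model[OF A, of "\<chi> j. sqrt (P i $ j * Q i $ j)"] pos by simp
  qed
  have "(\<lambda>i. \<chi> j. sqrt (P i $ j * Q i $ j) / (\<Sum>k\<in>UNIV. sqrt (P i $ k * Q i $ k)))
    \<longlonglongrightarrow> (\<chi> j. sqrt (p $ j * q $ j) / (\<Sum>k\<in>UNIV. sqrt (p $ k * q $ k)))"
    by (intro tendsto_intros P(2) Q(2) nz)
  with in_model show ?thesis
    unfolding extended_log_linear_model_def closure_sequential by fast
qed

section \<open>Existence and uniqueness of the extended MLE\<close>

lemma ex_extended_MLE:
  assumes "1 \<in> real_rowspan A"
  shows "\<exists>p. is_extended_MLE u A p"
  using continuous_attains_sup[OF compact_extended_log_linear_model _ continuous_on_likelihood]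
    log_linear_model_nonempty[OF assms] closure_subset[of "log_linear_model A"]
  by (fastforce simp: is_extended_MLE_def is_arg_max_linorder extended_log_linear_model_def)

text \<open>The normalised geometric mean of two distinct maximisers would have larger likelihood, because
  its normalising constant is less than 1.\<close>

lemma extended_MLE_unique:
  fixes A :: "int ^ 'm ^ 'd"
  assumes A: "1 \<in> real_rowspan A" and u: "(\<Sum>j\<in>UNIV. u $ j) \<ge> 1"
    and p: "is_extended_MLE u A p" and q: "is_extended_MLE u A q"
  shows "p = q"
proof (rule ccontr)
  assume neq: "p \<noteq> q"
  let ?E = "extended_log_linear_model A"
  let ?n = "\<Sum>j\<in>UNIV. u $ j"
  define Z where "Z = (\<Sum>k\<in>UNIV. sqrt (p $ k * q $ k))"
  have pE: "p \<in> ?E" "\<And>r. r \<in> ?E \<Longrightarrow> likelihood u r \<le> likelihood u p"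
    using p by (auto simp: is_extended_MLE_def is_arg_max_linorder)
  have qE: "q \<in> ?E" "\<And>r. r \<in> ?E \<Longrightarrow> likelihood u r \<le> likelihood u q"
    using q by (auto simp: is_extended_MLE_def is_arg_max_linorder)
  have eq: "likelihood u q = likelihood u p"
    using pE qE by (meson order_antisym)
  \<comment> \<open>Model points have positive likelihood, so the maximum is positive. Hence
    \<open>p\<close> and \<open>q\<close> are both nonzero wherever \<open>u\<close> is, which gives
    \<open>Z > 0\<close>.\<close>
  obtain r where r: "r \<in> log_linear_model A"
    using log_linear_model_nonempty[OF A] by blast
  then have "likelihood u r > 0"
    by (auto simp: likelihood_def log_linear_model_def intro!: prod_pos)
  moreover have "r \<in> ?E"
    using r closure_subset by (auto simp: extended_log_linear_model_def)
  ultimately have Lp: "likelihood u p > 0"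
    using pE(2) by fastforce
  have nonneg: "p $ j \<ge> 0" "q $ j \<ge> 0" for j
    using pE(1) qE(1) extended_log_linear_model_subset[of A] by (auto simp: prob_simplex_def)
  have sum1: "(\<Sum>j\<in>UNIV. p $ j) = 1" "(\<Sum>j\<in>UNIV. q $ j) = 1"
    using pE(1) qE(1) extended_log_linear_model_subset[of A] by (auto simp: prob_simplex_def)
  obtain j where j: "u $ j \<noteq> 0"
    using u by (metis not_one_le_zero sum.neutral)
  have "likelihood u p \<noteq> 0" "likelihood u q \<noteq> 0"
    using Lp eq by simp_all
  then have "p $ j \<noteq> 0" "q $ j \<noteq> 0"
    using j by (auto simp: likelihood_def)
  with nonneg have "sqrt (p $ j * q $ j) > 0"
    by (simp add: less_le)
  then have Z0: "Z > 0"
    unfolding Z_def using nonneg by (intro sum_pos2[of UNIV j]) auto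
  \<comment> \<open>AM-GM in each coordinate, strict where \<open>p\<close> and \<open>q\<close>
    differ.\<close>
  have "Z < (\<Sum>j\<in>UNIV. (p $ j + q $ j) / 2)"
    unfolding Z_def
  proof (rule sum_strict_mono_ex1)
    obtain i where i: "p $ i \<noteq> q $ i"
      using neq by (auto simp: vec_eq_iff)
    have "sqrt (p $ i * q $ i) \<noteq> (p $ i + q $ i) / 2"
    proof
      assume "sqrt (p $ i * q $ i) = (p $ i + q $ i) / 2"
      then have "p $ i * q $ i = ((p $ i + q $ i) / 2)\<^sup>2"
        using nonneg by (metis mult_nonneg_nonneg real_sqrt_pow2)
      then have "(p $ i - q $ i)\<^sup>2 = 0"
        by (simp add: power2_eq_square field_simps)
      with i show False by simp
    qed
    then have "sqrt (p $ i * q $ i) < (p $ i + q $ i) / 2"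
      using arith_geo_mean_sqrt[OF nonneg(1)[of i] nonneg(2)[of i]] by linarith
    then show "\<exists>j\<in>UNIV. sqrt (p $ j * q $ j) < (p $ j + q $ j) / 2"
      by blast
  qed (use nonneg in \<open>auto intro!: arith_geo_mean_sqrt simp del: le_divide_eq_numeral1\<close>)
  also have "\<dots> = 1"
    using sum1 by (simp add: sum.distrib flip: sum_divide_distrib)
  finally have Z1: "Z < 1" .
  have "likelihood u (\<chi> j. sqrt (p $ j * q $ j) / Z)
      = sqrt (likelihood u p) * sqrt (likelihood u q) / Z ^ ?n"
    by (simp add: likelihood_def power_divide prod_dividef real_sqrt_mult power_mult_distrib
        prod.distrib power_sum real_sqrt_power sqrt_prod)
  also have "\<dots> = likelihood u p / Z ^ ?n"
    using Lp by (simp add: eq)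
  also have "\<dots> > likelihood u p"
    using Lp Z0 Z1 u power_less_one_iff[of Z ?n] by (simp add: field_simps)
  finally show False
    using pE(2) extended_log_linear_model_geometric_mean[OF A pE(1) qE(1)] Z0
    by (fastforce simp: Z_def)
qed

text \<open>By continuity a bound on the model extends to its closure. This carries uniqueness over
  from extended MLEs to MLEs.\<close>

lemma is_MLE_imp_is_extended_MLE:
  assumes "is_MLE u A p"
  shows "is_extended_MLE u A p"
proof -
  have p: "p \<in> log_linear_model A"
    and max: "\<And>q. q \<in> log_linear_model A \<Longrightarrow> likelihood u q \<le> likelihood u p"
    using assms by (auto simp: is_MLE_def is_arg_max_linorder)
  have "likelihood u q \<le> likelihood u p" if "q \<in> extended_log_linear_model A" for q
    using continuous_le_on_closure[OF continuous_on_likelihood _ max] that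
    by (simp add: extended_log_linear_model_def)
  then show ?thesis
    using p closure_subset
    by (auto simp: is_extended_MLE_def is_arg_max_linorder extended_log_linear_model_def)
qed

section \<open>The action by \<open>nA\<close> with linearization \<open>b\<close>, and the
  likelihood\<close>

context
  fixes u :: "nat ^ 'm" and A :: "int ^ 'm ^ 'd" and n :: nat and b :: "int ^ 'd"
    and nA :: "int ^ 'm ^ 'd"
  assumes n: "n = (\<Sum>j\<in>UNIV. u $ j)" "n \<ge> 1"
    and A: "1 \<in> real_rowspan A"
    and b: "b = A *v (\<chi> j. int (u $ j))"
    and nA: "nA = (\<chi> i j. int n * A $ i $ j)"
begin

text \<open>The linearization shifts all coordinates by the same amount, which normalisation to a
  probability vector absorbs.\<close>

lemma weight_eq:
  "weight nA b \<theta> $ j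
    = real n * (\<Sum>i\<in>UNIV. \<theta> $ i * A $ i $ j) - (\<Sum>i\<in>UNIV. \<theta> $ i * b $ i)"
  by (simp add: weight_def nA sum_subtractf sum_distrib_left algebra_simps)

lemma inner_b_eq:
  "(\<Sum>i\<in>UNIV. \<theta> $ i * real_of_int (b $ i))
    = (\<Sum>j\<in>UNIV. real (u $ j) * (\<Sum>i\<in>UNIV. \<theta> $ i * real_of_int (A $ i $ j)))"
proof -
  have "(\<Sum>i\<in>UNIV. \<theta> $ i * real_of_int (b $ i))
      = (\<Sum>i\<in>UNIV. \<Sum>j\<in>UNIV. real (u $ j) * (\<theta> $ i * real_of_int (A $ i $ j)))"
    by (simp add: b matrix_vector_mult_def sum_distrib_left algebra_simps)
  also have "\<dots> = (\<Sum>j\<in>UNIV. \<Sum>i\<in>UNIV. real (u $ j) * (\<theta> $ i * real_of_int (A $ i $ j)))"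
    by (rule sum.swap)
  finally show ?thesis
    by (simp add: sum_distrib_left)
qed

text \<open>Infinitesimal invariance of the monomial with exponents \<open>u\<close>. The factor
  \<open>n\<close> on \<open>A\<close> balances the total count \<open>n\<close> that multiplies the
  shift by \<open>b\<close>.\<close>

lemma sum_u_weight_eq_0: "(\<Sum>j\<in>UNIV. real (u $ j) * weight nA b \<theta> $ j) = 0"
proof -
  define \<alpha> where "\<alpha> j = (\<Sum>i\<in>UNIV. \<theta> $ i * real_of_int (A $ i $ j))" for j
  define s where "s = (\<Sum>i\<in>UNIV. \<theta> $ i * real_of_int (b $ i))"
  have "(\<Sum>j\<in>UNIV. real (u $ j) * weight nA b \<theta> $ j)
      = (\<Sum>j\<in>UNIV. real n * (real (u $ j) * \<alpha> j) - real (u $ j) * s)"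
    by (simp add: weight_eq \<alpha>_def s_def right_diff_distrib mult.left_commute)
  also have "\<dots> = real n * (\<Sum>j\<in>UNIV. real (u $ j) * \<alpha> j) - real n * s"
    by (simp add: sum_subtractf n(1) flip: sum_distrib_left sum_distrib_right)
  also have "\<dots> = 0"
    by (simp add: s_def \<alpha>_def inner_b_eq)
  finally show ?thesis .
qed

text \<open>If \<theta> combines the rows of \<open>A\<close> to 1, its pairing with
  \<open>b\<close> is the total count \<open>n\<close>, so every weight is
  \<open>n - n\<close>.\<close>

lemma ex_weight_zero: "\<exists>\<theta>. \<theta> \<noteq> 0 \<and> weight nA b \<theta> = 0"
proof -
  obtain \<theta> :: "real ^ 'd" where \<theta>: "\<forall>j. (1 :: real ^ 'm) $ j = (\<Sum>i\<in>UNIV. \<theta> $ i * of_int (A $ i $ j))"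
    using A by (auto simp: mem_real_rowspan_iff)
  then have "\<theta> \<noteq> 0"
    by auto
  moreover have "weight nA b \<theta> = 0"
    using \<theta> by (simp add: vec_eq_iff weight_eq inner_b_eq n(1))
  ultimately show ?thesis by blast
qed

text \<open>The monomial with exponents \<open>u\<close> is a torus invariant, because \<open>b = A u\<close>.\<close>

lemma not_unstable_one: "\<not> is_unstable complex_torus (torus_act nA b) 1"
proof -
  let ?f = "\<lambda>v :: complex ^ 'm. \<Prod>j\<in>UNIV. norm (v $ j) ^ (u $ j)"
  have "?f (torus_act nA b l 1) = 1" if "l \<in> carrier complex_torus" for l
    using sum_u_weight_eq_0[of "\<chi> i. ln (norm (l $ i))"]
    by (simp add: norm_torus_act_one[OF that] flip: exp_of_nat_mult exp_sum)
  then have "?f ` orbit complex_torus (torus_act nA b) 1 \<subseteq> {1}"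
    by (auto simp: orbit_one_eq)
  moreover have "continuous_on S ?f" for S
    by (intro continuous_intros)
  ultimately have image: "?f ` closure (orbit complex_torus (torus_act nA b) 1) \<subseteq> {1}"
    by (intro image_closure_subset) auto
  \<comment> \<open>The factor at a coordinate with a nonzero count makes the monomial vanish at the
    origin.\<close>
  obtain j where "u $ j \<noteq> 0"
    using n by (metis not_one_le_zero sum.neutral)
  then have "?f 0 = 0"
    by (auto intro!: bexI[of _ j])
  then have "?f 0 \<notin> {1}"
    by (simp only: singleton_iff zero_neq_one not_False_eq_True)
  with image show ?thesis
    unfolding is_unstable_def by blast
qed

lemma exp_weight_sum_pos: "exp_weight_sum nA b \<theta> > 0"
  by (simp add: exp_weight_sum_def sum_pos)

text \<open>Here \<open>p\<close> is proportional to the exponentials of the weights, and total mass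
  one fixes the factor. The weights contribute 1 to the likelihood, leaving the \<open>n\<close>-th
  power of that factor. The constant \<open>c\<close> leaves room for a normalisation term.\<close>

lemma likelihood_eq_exp_weight_sum:
  assumes p: "p \<in> log_linear_model A"
    and \<theta>: "\<And>j. ln (p $ j) = (\<Sum>i\<in>UNIV. real n * \<theta> $ i * of_int (A $ i $ j)) + c"
  shows "likelihood u p = 1 / exp_weight_sum nA b \<theta> ^ n"
proof -
  let ?s = "\<Sum>i\<in>UNIV. \<theta> $ i * real_of_int (b $ i)"
  have pos: "p $ j > 0" for j
    using p by (auto simp: log_linear_model_def)
  have sum1: "(\<Sum>j\<in>UNIV. p $ j) = 1"
    using p by (auto simp: log_linear_model_def prob_simplex_def)
  have ln_p: "ln (p $ j) = weight nA b \<theta> $ j + ?s + c" for j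
    by (simp add: \<theta> weight_eq sum_distrib_left mult.assoc)
  then have p_eq: "p $ j = exp (weight nA b \<theta> $ j) * exp (?s + c)" for j
    using pos by (simp flip: exp_add add: add.assoc[symmetric] ln_p[symmetric])
  have "exp_weight_sum nA b \<theta> * exp (?s + c) = (\<Sum>j\<in>UNIV. p $ j)"
    by (simp add: p_eq exp_weight_sum_def sum_distrib_right)
  then have Z: "exp (?s + c) = 1 / exp_weight_sum nA b \<theta>"
    using sum1 exp_weight_sum_pos[of \<theta>] by (simp add: field_simps)
  have "likelihood u p = exp (\<Sum>j\<in>UNIV. real (u $ j) * weight nA b \<theta> $ j) * exp (?s + c) ^ n"
    unfolding likelihood_def p_eq power_mult_distrib prod.distrib
    by (simp add: exp_sum n(1) power_sum flip: exp_of_nat_mult)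
  then show ?thesis
    by (simp add: sum_u_weight_eq_0 Z power_one_over)
qed

lemma likelihood_image_eq:
  "likelihood u ` log_linear_model A = range (\<lambda>\<theta>. 1 / exp_weight_sum nA b \<theta> ^ n)"
proof (intro equalityI subsetI)
  fix y assume "y \<in> likelihood u ` log_linear_model A"
  then obtain p where p: "p \<in> log_linear_model A" "y = likelihood u p"
    by blast
  then obtain \<theta> :: "real ^ 'd" where "\<And>j. ln (p $ j) = (\<Sum>i\<in>UNIV. \<theta> $ i * of_int (A $ i $ j))"
    by (auto simp: log_linear_model_def mem_real_rowspan_iff)
  then show "y \<in> range (\<lambda>\<theta>. 1 / exp_weight_sum nA b \<theta> ^ n)"
    \<comment> \<open>Dividing by \<open>n\<close> undoes the scaling of \<open>A\<close>.\<close>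
    using likelihood_eq_exp_weight_sum[OF p(1), of "(1 / real n) *\<^sub>R \<theta>" 0] p(2) n(2) by simp
next
  fix y assume "y \<in> range (\<lambda>\<theta>. 1 / exp_weight_sum nA b \<theta> ^ n)"
  then obtain \<theta> where y: "y = 1 / exp_weight_sum nA b \<theta> ^ n"
    by blast
  define q :: "real ^ 'm" where
    "q = (\<chi> j. exp (\<Sum>i\<in>UNIV. real n * \<theta> $ i * of_int (A $ i $ j)))"
  have q: "q $ j > 0" for j
    by (simp add: q_def)
  let ?Z = "\<Sum>k\<in>UNIV. q $ k"
  have Z: "?Z > 0"
    using q by (intro sum_pos) auto
  have "(\<chi> j. ln (q $ j)) \<in> real_rowspan A"
    unfolding mem_real_rowspan_iff by (rule exI[of _ "real n *\<^sub>R \<theta>"]) (simp add: q_def)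
  then have p: "(\<chi> j. q $ j / ?Z) \<in> log_linear_model A"
    using normalize_in_log_linear_model[OF A q] by blast
  have "likelihood u (\<chi> j. q $ j / ?Z) = y"
    unfolding y using q Z
    by (intro likelihood_eq_exp_weight_sum[OF p, of _ "- ln ?Z"]) (simp add: ln_divide_pos, simp add: q_def)
  with p show "y \<in> likelihood u ` log_linear_model A"
    by blast
qed

text \<open>Likelihood values are inverse \<open>n\<close>-th powers of the positive exponential
  sums, so maximising one is minimising the other.\<close>

lemma ex_MLE_iff:
  "(\<exists>p. is_MLE u A p) \<longleftrightarrow> (\<exists>\<theta>. \<forall>\<eta>. exp_weight_sum nA b \<theta> \<le> exp_weight_sum nA b \<eta>)"
proof -
  have "(\<exists>p. is_MLE u A p)
      \<longleftrightarrow> (\<exists>y\<in>likelihood u ` log_linear_model A. \<forall>z\<in>likelihood u ` log_linear_model A. z \<le> y)"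
    by (auto simp: is_MLE_def is_arg_max_linorder)
  also have "\<dots> \<longleftrightarrow> (\<exists>\<theta>. \<forall>\<eta>. exp_weight_sum nA b \<theta> ^ n \<le> exp_weight_sum nA b \<eta> ^ n)"
    unfolding likelihood_image_eq using exp_weight_sum_pos by (simp add: field_simps)
  also have "\<dots> \<longleftrightarrow> (\<exists>\<theta>. \<forall>\<eta>. exp_weight_sum nA b \<theta> \<le> exp_weight_sum nA b \<eta>)"
    using n(2) exp_weight_sum_pos by (simp add: power_mono_iff less_imp_le)
  finally show ?thesis .
qed

end

theorem theorem4p3:
  fixes u :: "nat ^ 'm" and A :: "int ^ 'm ^ 'd" and n :: nat and b :: "int ^ 'd"
    and nA :: "int ^ 'm ^ 'd"
  assumes n: "n = (\<Sum>j\<in>UNIV. u $ j)" "n \<ge> 1"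
    and A: "1 \<in> real_rowspan A"
    and b: "b = A *v (\<chi> j. int (u $ j))"
    and nA: "nA = (\<chi> i j. int n * A $ i $ j)"
  shows "\<not> is_unstable complex_torus (torus_act nA b) 1
    \<and> (is_semistable complex_torus (torus_act nA b) 1 \<longleftrightarrow> (\<exists>!p. is_extended_MLE u A p))
    \<and> (is_polystable complex_torus (torus_act nA b) 1 \<longleftrightarrow> (\<exists>!p. is_MLE u A p))
    \<and> \<not> is_stable complex_torus (torus_act nA b) 1"
proof (intro conjI)
  note asm = n A b nA
  show unst: "\<not> is_unstable complex_torus (torus_act nA b) 1"
    by (rule not_unstable_one[OF asm])
  have unique: "p = q" if "is_extended_MLE u A p" "is_extended_MLE u A q" for p q
    using extended_MLE_unique[OF A _ that] n by simp
  show "is_semistable complex_torus (torus_act nA b) 1 \<longleftrightarrow> (\<exists>!p. is_extended_MLE u A p)"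
    using unst ex_extended_MLE[OF A] unique by (auto simp: is_unstable_def is_semistable_def)
  \<comment> \<open>Uniqueness is inherited from the extended MLE, so only existence is compared
    with polystability.\<close>
  show "is_polystable complex_torus (torus_act nA b) 1 \<longleftrightarrow> (\<exists>!p. is_MLE u A p)"
    unfolding is_polystable_one_iff ex_MLE_iff[OF asm, symmetric]
    using unique is_MLE_imp_is_extended_MLE by blast
  show "\<not> is_stable complex_torus (torus_act nA b) 1"
    using ex_weight_zero[OF asm] infinite_stabilizer_one by (auto simp: is_stable_def)
qed

end
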